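(* Let $G$ be a connected graph with $n$ vertices and diameter $2$. Then $BH(G)\leq BH(K_{1,\,n-1})$ with equality if and only if $G=K_{1,\,n-1}$.
   Context: $K_{1,n-1}$ is the star on $n$ vertices. For a graph $G$ on $n$ vertices with Laplacian $L(G)=D(G)-A(G)$ and Laplacian eigenvalues $0=\lambda_1\le\lambda_2\le\cdots\le\lambda_n$, the biharmonic index is $BH(G)=\frac12\sum_{u,v}d_B^2(u,v)$ ($d_B^2$ the squared biharmonic distance), equivalently $BH(G)=n\sum_{i=2}^n\lambda_i^{-2}$. *)

theory Defs
  imports
    "HOL-Analysis.Analysis"
    "Graph_Theory.Graph_Theory"
    "Graph_Theory.Kuratowski"
begin

text \<open>
  A finite simple graph is a symmetric loop-free digraph without multiple arcs
  (\<^locale>\<open>graph\<close>), so each edge is a pair of opposite arcs and the degree of a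
  vertex is its out-degree.  Vertices come from a finite type, so that matrices indexed by
  vertices have type \<^typ>\<open>real^'v^'v\<close>.  Elements of the type that are not vertices of the
  graph contribute zero rows and columns to all matrices below, including pseudoinverses, so
  these restrict on \<^term>\<open>verts G\<close> to the usual matrices of the graph.
\<close>

text \<open>The extended real \<^term>\<open>wf_digraph.\<mu> G (\<lambda>_. 1) u v\<close> is the least number of arcs of
  a walk from \<open>u\<close> to \<open>v\<close>, and infinite if there is none.\<close>

definition graph_diameter :: "('v, 'e) pre_digraph \<Rightarrow> ereal" where
  "graph_diameter G = (SUP u\<in>verts G. SUP v\<in>verts G. wf_digraph.\<mu> G (\<lambda>_. 1) u v)"

definition degree_matrix :: "('v::finite, 'e) pre_digraph \<Rightarrow> real^'v^'v" where
  "degree_matrix G = (\<chi> u v. if u = v then real (out_degree G u) else 0)"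

definition adjacency_matrix :: "('v::finite, 'e) pre_digraph \<Rightarrow> real^'v^'v" where
  "adjacency_matrix G = (\<chi> u v. if u \<rightarrow>\<^bsub>G\<^esub> v then 1 else 0)"

definition laplacian :: "('v::finite, 'e) pre_digraph \<Rightarrow> real^'v^'v" where
  "laplacian G = degree_matrix G - adjacency_matrix G"

definition is_moore_penrose_inverse :: "real^'n^'m \<Rightarrow> real^'m^'n \<Rightarrow> bool" where
  "is_moore_penrose_inverse A X \<longleftrightarrow>
     A ** X ** A = A \<and> X ** A ** X = X \<and>
     transpose (A ** X) = A ** X \<and> transpose (X ** A) = X ** A"

definition moore_penrose_inverse :: "real^'n^'m \<Rightarrow> real^'m^'n" where
  "moore_penrose_inverse A = (THE X. is_moore_penrose_inverse A X)"

text \<open>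
  The squared biharmonic distance is the squared resistance-type distance formed with the
  pseudoinverse of the squared Laplacian (the biharmonic operator).
\<close>

definition biharmonic_distance_sq :: "('v::finite, 'e) pre_digraph \<Rightarrow> 'v \<Rightarrow> 'v \<Rightarrow> real" where
  "biharmonic_distance_sq G u v =
     (let B = moore_penrose_inverse (laplacian G ** laplacian G)
      in B $ u $ u + B $ v $ v - 2 * B $ u $ v)"

text \<open>The sum runs over ordered pairs of vertices, which explains the factor one half.\<close>

definition biharmonic_index :: "('v::finite, 'e) pre_digraph \<Rightarrow> real" where
  "biharmonic_index G =
     (1 / 2) * (\<Sum>u\<in>verts G. \<Sum>v\<in>verts G. biharmonic_distance_sq G u v)"

end

theory Submission
  imports Defs
begin

text \<open>
  If \<open>x\<close> is a nonconstant eigenvector of the Laplacian for the eigenvalue \<open>l\<close>, let \<open>x\<close> be maximal at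
  \<open>u\<close> and minimal at \<open>v\<close>.  The difference of the eigenvalue equations at \<open>u\<close> and \<open>v\<close> is a sum of
  nonnegative terms, and a path of length at most two from \<open>u\<close> to \<open>v\<close> already contributes
  \<open>x\<^sub>u - x\<^sub>v\<close>, so \<open>l \<ge> 1\<close>; the equation at \<open>u\<close> gives \<open>l \<le> n\<close>.  Bounding the convex function
  \<open>1 / l\<^sup>2\<close> on \<open>[1, n]\<close> by its chord, the biharmonic index is at most a decreasing affine function of
  the trace of the Laplacian, which is the number of arcs.  For the star all eigenvalues in question
  are \<open>1\<close> or \<open>n\<close> and this bound is attained; any other graph of diameter two has more arcs.
\<close>

section \<open>Spectral theorem for self-adjoint maps on invariant subspaces\<close>

text \<open>The quadratic form of \<open>f\<close> attains its maximum on the compact unit sphere of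
  \<open>S\<close>. The residual at a maximiser lies in \<open>S\<close> and must vanish, since
  moving along it would otherwise increase the Rayleigh quotient.\<close>

lemma self_adjoint_eigenvector:
  fixes f :: "'a::euclidean_space \<Rightarrow> 'a"
  assumes lin: "linear f" and sa: "\<And>x y. f x \<bullet> y = x \<bullet> f y"
    and S: "subspace S" "f ` S \<subseteq> S" "S \<noteq> {0}"
  obtains x m where "x \<in> S" "norm x = 1" "f x = m *\<^sub>R x"
proof -
  interpret linear f by fact
  let ?K = "S \<inter> sphere 0 1"
  obtain s where s: "s \<in> S" "s \<noteq> 0"
    using S subspace_0 by blast
  then have "(1 / norm s) *\<^sub>R s \<in> ?K"
    using S(1) by (auto intro: subspace_scale)
  moreover have "compact ?K"
    using closed_subspace[OF S(1)] by (simp add: closed_Int_compact)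
  moreover have "continuous_on ?K (\<lambda>x. x \<bullet> f x)"
    by (intro continuous_intros linear_continuous_on linear_conv_bounded_linear[THEN iffD1] lin)
  ultimately obtain x where x: "x \<in> ?K" and max: "\<And>y. y \<in> ?K \<Longrightarrow> y \<bullet> f y \<le> x \<bullet> f x"
    using continuous_attains_sup[of ?K "\<lambda>x. x \<bullet> f x"] by blast
  define m where "m = x \<bullet> f x"
  \<comment> \<open>Homogeneity carries the maximum from the unit sphere to all of
    \<open>S\<close>.\<close>
  have q: "y \<bullet> f y \<le> m * (y \<bullet> y)" if "y \<in> S" for y
  proof (cases "y = 0")
    case False
    then have "(1 / norm y) *\<^sub>R y \<in> ?K"
      using that S(1) by (auto intro: subspace_scale)
    from max[OF this] False show ?thesis
      by (simp add: scale m_def power2_norm_eq_inner[symmetric] power2_eq_square field_simps)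
  qed (simp add: zero)
  define r where "r = f x - m *\<^sub>R x"
  have r: "r \<in> S"
    using x S by (auto simp: r_def intro!: subspace_diff subspace_scale)
  have xx: "x \<bullet> x = 1"
    using x by (simp add: norm_eq_1)
  \<comment> \<open>First-order optimality along the line through the maximiser in direction of the residual.\<close>
  have opt: "2 * t * (r \<bullet> r) \<le> t\<^sup>2 * (m * (r \<bullet> r) - r \<bullet> f r)" for t
  proof -
    have "x + t *\<^sub>R r \<in> S"
      using x r S(1) by (auto intro: subspace_add subspace_scale)
    from q[OF this]
    have "m + 2 * t * (r \<bullet> f x) + t\<^sup>2 * (r \<bullet> f r) \<le> m * (1 + 2 * t * (r \<bullet> x) + t\<^sup>2 * (r \<bullet> r))"
      using sa[of x r] by (simp add: add scale inner_simps xx inner_commute m_def[symmetric] power2_eq_square algebra_simps)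
    moreover have "r \<bullet> f x = r \<bullet> r + m * (r \<bullet> x)"
      unfolding r_def by (simp add: inner_diff_right)
    ultimately show ?thesis
      by (simp add: algebra_simps)
  qed
  have "r \<bullet> r = 0"
  proof (rule ccontr)
    assume "r \<bullet> r \<noteq> 0"
    then have pos: "r \<bullet> r > 0" by simp
    \<comment> \<open>\<open>a\<close> bounds the coefficient of \<open>t\<^sup>2\<close> in
      \<open>opt\<close>, and the summand \<open>r \<bullet> r\<close> makes it positive. The choice
      of \<open>t\<close> turns \<open>t\<^sup>2 * a\<close> into
      \<open>t * (r \<bullet> r)\<close>, half of the left-hand side.\<close>
    define a where "a = \<bar>m * (r \<bullet> r) - r \<bullet> f r\<bar> + r \<bullet> r"
    have a: "a > 0" unfolding a_def using pos by (intro add_nonneg_pos) auto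
    define t where "t = (r \<bullet> r) / a"
    have t: "t > 0" using pos a by (simp add: t_def)
    have "m * (r \<bullet> r) - r \<bullet> f r \<le> a"
      unfolding a_def using pos by linarith
    then have "2 * t * (r \<bullet> r) \<le> t\<^sup>2 * a"
      using opt[of t] by (meson mult_left_mono order_trans zero_le_power2)
    also have "\<dots> = t * (r \<bullet> r)"
      using a by (simp add: t_def power2_eq_square)
    finally show False using t pos by simp
  qed
  then have "f x = m *\<^sub>R x" by (simp add: r_def)
  with x that show ?thesis by auto
qed

text \<open>The eigenvalue of \<open>b\<close> is written \<open>b \<bullet> f b\<close>, which
  saves a separate function. Spanning is encoded as the Fourier expansion, the form in which it is
  applied.\<close>

definition orthonormal_eigenbasis :: "('a::euclidean_space \<Rightarrow> 'a) \<Rightarrow> 'a set \<Rightarrow> 'a set \<Rightarrow> bool" where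
  "orthonormal_eigenbasis f S B \<longleftrightarrow> finite B \<and> B \<subseteq> S \<and>
     (\<forall>b\<in>B. \<forall>b'\<in>B. b \<bullet> b' = (if b = b' then 1 else 0)) \<and>
     (\<forall>b\<in>B. f b = (b \<bullet> f b) *\<^sub>R b) \<and> (\<forall>s\<in>S. s = (\<Sum>b\<in>B. (b \<bullet> s) *\<^sub>R b))"

text \<open>Induction on the dimension: an eigenvector is split off, and self-adjointness keeps its
  orthogonal complement in \<open>S\<close> invariant.\<close>

theorem orthonormal_eigenbasis_exists:
  fixes f :: "'a::euclidean_space \<Rightarrow> 'a"
  assumes lin: "linear f" and sa: "\<And>x y. f x \<bullet> y = x \<bullet> f y"
    and "subspace S" "f ` S \<subseteq> S"
  shows "\<exists>B. orthonormal_eigenbasis f S B"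
  using assms(3,4)
proof (induction "dim S" arbitrary: S rule: less_induct)
  case less
  show ?case
  proof (cases "S = {0}")
    case True
    then show ?thesis
      by (auto simp: orthonormal_eigenbasis_def intro: exI[of _ "{}"])
  next
    case False
    obtain x m where x: "x \<in> S" "norm x = 1" "f x = m *\<^sub>R x"
      using self_adjoint_eigenvector[OF lin sa less.prems False] by blast
    have xx: "x \<bullet> x = 1"
      using x by (simp add: norm_eq_1)
    define T where "T = {y \<in> S. x \<bullet> y = 0}"
    have T: "subspace T"
      using less.prems(1) by (auto simp: T_def subspace_def inner_simps)
    have fT: "f ` T \<subseteq> T"
      using less.prems(2) x(3) by (auto simp: T_def sa[symmetric])
    have "T \<subset> S"
      unfolding T_def using x(1) xx by force
    then have "dim T < dim S"
      by (simp add: dim_psubset span_eq_iff[THEN iffD2] T less.prems(1))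
    from less.hyps[OF this T fT] obtain B where B: "orthonormal_eigenbasis f T B" by blast
    have Bx: "x \<bullet> b = 0" "b \<bullet> x = 0" if "b \<in> B" for b
      using B that by (auto simp: orthonormal_eigenbasis_def T_def inner_commute)
    have xB: "x \<notin> B"
      using Bx xx by force
    have fB: "finite B"
      using B by (simp add: orthonormal_eigenbasis_def)
    have "s = (\<Sum>b\<in>insert x B. (b \<bullet> s) *\<^sub>R b)" if s: "s \<in> S" for s
    proof -
      \<comment> \<open>Removing the component along \<open>x\<close> lands in \<open>T\<close>; the
        other coefficients do not change because \<open>B\<close> is orthogonal to
        \<open>x\<close>.\<close>
      have "s - (x \<bullet> s) *\<^sub>R x \<in> T"
        using s x less.prems(1) by (auto simp: T_def inner_diff_right xx intro: subspace_diff subspace_scale)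
      then have "s - (x \<bullet> s) *\<^sub>R x = (\<Sum>b\<in>B. (b \<bullet> (s - (x \<bullet> s) *\<^sub>R x)) *\<^sub>R b)"
        using B unfolding orthonormal_eigenbasis_def by blast
      also have "\<dots> = (\<Sum>b\<in>B. (b \<bullet> s) *\<^sub>R b)"
        by (intro sum.cong) (auto simp: inner_simps Bx)
      finally show ?thesis
        using xB fB by (simp add: algebra_simps)
    qed
    moreover have "f x = (x \<bullet> f x) *\<^sub>R x"
      using x xx by simp
    ultimately have "orthonormal_eigenbasis f S (insert x B)"
      using B Bx x xx unfolding orthonormal_eigenbasis_def T_def by auto
    then show ?thesis by blast
  qed
qed

section \<open>Moore-Penrose inverses and spectral sums\<close>

text \<open>\<open>A ** X\<close> and \<open>A ** Y\<close> are symmetric and each absorbs the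
  other, so transposing their product identifies them; likewise \<open>X ** A\<close> and
  \<open>Y ** A\<close>. Then \<open>X ** A ** X\<close> turns into
  \<open>Y ** A ** Y\<close>.\<close>

lemma moore_penrose_inverse_unique:
  fixes A :: "real^'n^'m"
  assumes X: "is_moore_penrose_inverse A X" and Y: "is_moore_penrose_inverse A Y"
  shows "X = Y"
proof -
  note x = X[unfolded is_moore_penrose_inverse_def] and y = Y[unfolded is_moore_penrose_inverse_def]
  have "A ** X = (A ** Y) ** (A ** X)"
    using y by (simp add: matrix_mul_assoc)
  also have "\<dots> = transpose ((A ** X) ** (A ** Y))"
    by (metis x y matrix_transpose_mul)
  also have "(A ** X) ** (A ** Y) = A ** Y"
    using x by (simp add: matrix_mul_assoc)
  also have "transpose (A ** Y) = A ** Y"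
    using y by simp
  finally have l: "A ** X = A ** Y" .
  have "X ** A = (X ** A) ** (Y ** A)"
    using y by (metis matrix_mul_assoc)
  also have "\<dots> = transpose ((Y ** A) ** (X ** A))"
    by (metis x y matrix_transpose_mul)
  also have "(Y ** A) ** (X ** A) = Y ** A"
    using x by (metis matrix_mul_assoc)
  also have "transpose (Y ** A) = Y ** A"
    using y by simp
  finally have r: "X ** A = Y ** A" .
  have "X = X ** (A ** X)"
    using x by (simp add: matrix_mul_assoc)
  also have "\<dots> = (X ** A) ** Y"
    by (simp add: l matrix_mul_assoc)
  also have "\<dots> = Y"
    using r y by simp
  finally show ?thesis .
qed

lemma moore_penrose_inverse_eqI:
  "is_moore_penrose_inverse A X \<Longrightarrow> moore_penrose_inverse A = X"
  unfolding moore_penrose_inverse_def by (blast intro: moore_penrose_inverse_unique)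

text \<open>For orthonormal \<open>B\<close> this is the functional calculus: the operator with
  eigenvalue \<open>g b\<close> at each \<open>b\<close> and zero on the orthogonal complement of
  \<open>B\<close>.\<close>

definition spectral_matrix :: "(real^'n) set \<Rightarrow> (real^'n \<Rightarrow> real) \<Rightarrow> real^'n^'n" where
  "spectral_matrix B g = (\<chi> i j. \<Sum>b\<in>B. g b * b $ i * b $ j)"

lemma transpose_spectral_matrix [simp]: "transpose (spectral_matrix B g) = spectral_matrix B g"
  by (simp add: spectral_matrix_def transpose_def vec_eq_iff mult_ac)

lemma matrix_mul_spectral_matrix:
  fixes A :: "real^'n^'n"
  assumes "\<And>b. b \<in> B \<Longrightarrow> A *v b = h b *\<^sub>R b"
  shows "A ** spectral_matrix B g = spectral_matrix B (\<lambda>b. h b * g b)"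
proof -
  have "(\<Sum>k\<in>UNIV. A $ i $ k * (\<Sum>b\<in>B. g b * b $ k * b $ j)) = (\<Sum>b\<in>B. g b * (A *v b) $ i * b $ j)" for i j
    by (simp add: matrix_vector_mult_def sum_distrib_left sum_distrib_right mult_ac sum.swap[of _ B UNIV])
  then show ?thesis
    using assms by (simp add: matrix_matrix_mult_def spectral_matrix_def vec_eq_iff mult_ac)
qed

text \<open>Orthonormality makes each \<open>b\<close> an eigenvector of
  \<open>spectral_matrix B g\<close> for \<open>g b\<close>, so
  \<open>matrix_mul_spectral_matrix\<close> applies.\<close>

lemma spectral_matrix_mul:
  assumes on: "\<And>b b'. b \<in> B \<Longrightarrow> b' \<in> B \<Longrightarrow> b \<bullet> b' = (if b = b' then 1 else 0)" and "finite B"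
  shows "spectral_matrix B g ** spectral_matrix B h = spectral_matrix B (\<lambda>b. g b * h b)"
proof (rule matrix_mul_spectral_matrix)
  fix b assume b: "b \<in> B"
  have "(spectral_matrix B g *v b) $ i = (\<Sum>b'\<in>B. g b' * b' $ i * (b' \<bullet> b))" for i
    by (simp add: matrix_vector_mult_def spectral_matrix_def inner_vec_def sum_distrib_left
        sum_distrib_right mult_ac sum.swap[of _ B UNIV])
  also have "\<dots> i = (g b *\<^sub>R b) $ i" for i
  proof -
    have "(\<Sum>b'\<in>B. g b' * b' $ i * (b' \<bullet> b)) = (\<Sum>b'\<in>B. if b' = b then g b * b $ i else 0)"
      using b by (intro sum.cong) (auto simp: on)
    then show ?thesis using b \<open>finite B\<close> by simp
  qed
  finally show "spectral_matrix B g *v b = g b *\<^sub>R b"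
    by (simp add: vec_eq_iff)
qed

text \<open>Both products are the spectral matrix of the constant 1, which is symmetric and fixes
  both factors; these are the Penrose equations.\<close>

lemma moore_penrose_inverse_spectral_matrix:
  assumes on: "\<And>b b'. b \<in> B \<Longrightarrow> b' \<in> B \<Longrightarrow> b \<bullet> b' = (if b = b' then 1 else 0)" and "finite B"
    and nz: "\<And>b. b \<in> B \<Longrightarrow> g b \<noteq> 0"
  shows "moore_penrose_inverse (spectral_matrix B g) = spectral_matrix B (\<lambda>b. 1 / g b)"
proof (rule moore_penrose_inverse_eqI)
  have "spectral_matrix B (\<lambda>b. h b * k b) = spectral_matrix B h" if "\<And>b. b \<in> B \<Longrightarrow> k b = 1" for h k
    using that by (simp add: spectral_matrix_def cong: sum.cong)
  then show "is_moore_penrose_inverse (spectral_matrix B g) (spectral_matrix B (\<lambda>b. 1 / g b))"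
    using nz by (simp add: is_moore_penrose_inverse_def spectral_matrix_mul[OF on \<open>finite B\<close>])
      (simp add: spectral_matrix_def cong: sum.cong)
qed

lemma trace_spectral_matrix:
  "trace (spectral_matrix B g) = (\<Sum>b\<in>B. g b * (b \<bullet> b))"
  by (simp add: trace_def spectral_matrix_def inner_vec_def sum_distrib_left mult_ac sum.swap[of _ B UNIV])

section \<open>The graph Laplacian: action, symmetry and trace\<close>

context graph begin

lemma ends_in_verts: "u \<rightarrow> v \<Longrightarrow> u \<in> verts G \<and> v \<in> verts G"
  using adj_in_verts by blast

lemma dominates_commute: "u \<rightarrow> v \<longleftrightarrow> v \<rightarrow> u"
  using graph_symmetric by blast

lemma not_dominates_self: "\<not> u \<rightarrow> u"
  using adj_not_same by blast

lemma finite_arcs_ends: "finite (arcs_ends G)"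
  by (simp add: arcs_ends_def)

lemma out_degree_eq_card_neighbours: "out_degree G u = card {v. u \<rightarrow> v}"
proof -
  have "bij_betw (head G) (out_arcs G u) {v. u \<rightarrow> v}"
    by (auto simp: bij_betw_def arcs_ends_conv inj_on_def arc_to_ends_def intro: no_multi_arcs)
  then show ?thesis
    by (simp add: out_degree_def bij_betw_same_card)
qed

end

lemma laplacian_mult:
  fixes G :: "('v::finite, 'e) pre_digraph"
  assumes "graph G"
  shows "(laplacian G *v x) $ u = (\<Sum>w | u \<rightarrow>\<^bsub>G\<^esub> w. x $ u - x $ w)"
proof -
  interpret graph G by fact
  have "(laplacian G *v x) $ u =
      (\<Sum>w\<in>UNIV. if u = w then real (out_degree G u) * x $ u else 0) - (\<Sum>w\<in>UNIV. if u \<rightarrow>\<^bsub>G\<^esub> w then x $ w else 0)"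
    by (simp add: laplacian_def degree_matrix_def adjacency_matrix_def matrix_vector_mult_def
        left_diff_distrib sum_subtractf if_distrib[of "\<lambda>a. a * _"] cong: if_cong)
  also have "\<dots> = (\<Sum>w | u \<rightarrow>\<^bsub>G\<^esub> w. x $ u - x $ w)"
    by (simp add: out_degree_eq_card_neighbours sum_subtractf sum.If_cases)
  finally show ?thesis .
qed

lemma laplacian_symmetric:
  fixes G :: "('v::finite, 'e) pre_digraph"
  assumes "graph G"
  shows "transpose (laplacian G) = laplacian G"
proof -
  interpret graph G by fact
  show ?thesis
    using dominates_commute
    by (auto simp: laplacian_def degree_matrix_def adjacency_matrix_def transpose_def vec_eq_iff)
qed

lemma laplacian_self_adjoint:
  fixes G :: "('v::finite, 'e) pre_digraph"
  assumes "graph G"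
  shows "(laplacian G *v x) \<bullet> y = x \<bullet> (laplacian G *v y)"
  by (metis assms dot_lmul_matrix laplacian_symmetric transpose_matrix_vector)

text \<open>Without loops the diagonal carries only the degrees, and their sum counts ordered
  adjacent pairs, that is, every edge twice.\<close>

lemma trace_laplacian:
  fixes G :: "('v::finite, 'e) pre_digraph"
  assumes "graph G"
  shows "trace (laplacian G) = card (arcs_ends G)"
proof -
  interpret graph G by fact
  have E: "(SIGMA u:UNIV. {v. u \<rightarrow>\<^bsub>G\<^esub> v}) = arcs_ends G"
    by auto
  have "card (arcs_ends G) = (\<Sum>u\<in>UNIV. card {v. u \<rightarrow>\<^bsub>G\<^esub> v})"
    using card_SigmaI[of UNIV "\<lambda>u. {v. u \<rightarrow>\<^bsub>G\<^esub> v}"] unfolding E by simp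
  then show ?thesis
    by (simp add: trace_def laplacian_def degree_matrix_def adjacency_matrix_def
        not_dominates_self out_degree_eq_card_neighbours)
qed

section \<open>Spectral formula for the biharmonic index\<close>

text \<open>The orthogonal complement of the constant vector among vectors supported on
  \<open>V\<close>; the support condition discards elements of the type that are not
  vertices.\<close>

definition zero_sum_vectors :: "'v set \<Rightarrow> (real^'v) set" where
  "zero_sum_vectors V = {x. (\<forall>v. v \<notin> V \<longrightarrow> x $ v = 0) \<and> (\<Sum>v\<in>V. x $ v) = 0}"

lemma subspace_zero_sum_vectors: "subspace (zero_sum_vectors V)"
  by (auto simp: zero_sum_vectors_def subspace_def sum.distrib sum_distrib_left[symmetric])

text \<open>The entries sum to the inner product with the all-ones vector, which the self-adjoint
  Laplacian annihilates.\<close>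

lemma laplacian_zero_sum_vectors:
  fixes G :: "('v::finite, 'e) pre_digraph"
  assumes "graph G"
  shows "laplacian G *v x \<in> zero_sum_vectors (verts G)"
proof -
  interpret graph G by fact
  have zero: "(laplacian G *v x) $ u = 0" if "u \<notin> verts G" for u
    using that ends_in_verts by (auto simp: laplacian_mult[OF assms] intro!: sum.neutral)
  have "(\<Sum>u\<in>verts G. (laplacian G *v x) $ u) = (\<Sum>u\<in>UNIV. (laplacian G *v x) $ u)"
    using zero by (intro sum.mono_neutral_left) auto
  also have "\<dots> = (laplacian G *v x) \<bullet> 1"
    by (simp add: inner_vec_def)
  also have "\<dots> = x \<bullet> (laplacian G *v 1)"
    by (rule laplacian_self_adjoint[OF assms])
  also have "laplacian G *v 1 = 0"
    by (simp add: vec_eq_iff laplacian_mult[OF assms])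
  finally show ?thesis
    using zero by (simp add: zero_sum_vectors_def)
qed

text \<open>For nonempty \<open>V\<close>, the orthogonal projection onto
  \<open>zero_sum_vectors V\<close>: identity minus averaging on the block of
  \<open>V\<close>.\<close>

definition zero_sum_projection :: "'v set \<Rightarrow> real^'v^'v" where
  "zero_sum_projection V =
     (\<chi> i j. if i \<in> V \<and> j \<in> V then (if i = j then 1 else 0) - 1 / card V else 0)"

text \<open>Column \<open>j\<close> of the projection is itself a zero-sum vector with coefficient
  \<open>b $ j\<close> along \<open>b\<close>; its expansion in \<open>B\<close> is the completeness
  relation.\<close>

lemma spectral_matrix_const_1:
  fixes B :: "(real^'v::finite) set"
  assumes B: "orthonormal_eigenbasis f (zero_sum_vectors V) B" and V: "V \<noteq> {}"
  shows "spectral_matrix B (\<lambda>_. 1) = zero_sum_projection V"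
proof -
  have "zero_sum_projection V $ i $ j = (\<Sum>b\<in>B. b $ i * b $ j)" for i j
  proof -
    define p :: "real^'v" where "p = (\<chi> i. zero_sum_projection V $ i $ j)"
    have "p \<in> zero_sum_vectors V"
      using V by (cases "j \<in> V")
        (auto simp: p_def zero_sum_vectors_def zero_sum_projection_def sum_subtractf)
    then have "p = (\<Sum>b\<in>B. (b \<bullet> p) *\<^sub>R b)"
      using B unfolding orthonormal_eigenbasis_def by blast
    then have "p $ i = (\<Sum>b\<in>B. (b \<bullet> p) *\<^sub>R b) $ i"
      by (rule arg_cong)
    also have "\<dots> = (\<Sum>b\<in>B. (b \<bullet> p) * b $ i)"
      by simp
    also have "\<dots> = (\<Sum>b\<in>B. b $ i * b $ j)"
    proof (intro sum.cong refl)
      fix b assume "b \<in> B"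
      then have b: "b \<in> zero_sum_vectors V"
        using B by (auto simp: orthonormal_eigenbasis_def)
      have "b \<bullet> p = (\<Sum>k\<in>V. b $ k * p $ k)"
        unfolding inner_vec_def using b
        by (intro sum.mono_neutral_cong_right) (auto simp: zero_sum_vectors_def)
      also have "\<dots> = b $ j"
      proof (cases "j \<in> V")
        case True
        have "(\<Sum>k\<in>V. b $ k * p $ k) = (\<Sum>k\<in>V. (if k = j then b $ j else 0) - b $ k / card V)"
          using True by (intro sum.cong) (auto simp: p_def zero_sum_projection_def algebra_simps)
        also have "\<dots> = b $ j"
          using True b by (simp add: sum_subtractf sum_divide_distrib[symmetric] zero_sum_vectors_def)
        finally show ?thesis .
      next
        case False
        then show ?thesis
          using b by (simp add: p_def zero_sum_projection_def zero_sum_vectors_def)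
      qed
      finally show "b \<bullet> p * b $ i = b $ i * b $ j" by simp
    qed
    finally show ?thesis by (simp add: p_def)
  qed
  then show ?thesis
    by (simp add: vec_eq_iff spectral_matrix_def)
qed

text \<open>On \<open>verts G\<close> a column of the projection differs from the unit vector by a
  constant, and the Laplacian sees only differences along arcs.\<close>

lemma laplacian_mult_zero_sum_projection:
  fixes G :: "('v::finite, 'e) pre_digraph"
  assumes "graph G"
  shows "laplacian G ** zero_sum_projection (verts G) = laplacian G"
proof -
  interpret graph G by fact
  have "(laplacian G ** zero_sum_projection (verts G)) $ i $ j = laplacian G $ i $ j" for i j
  proof -
    define p :: "real^'v" where "p = (\<chi> i. zero_sum_projection (verts G) $ i $ j)"
    have "(laplacian G ** zero_sum_projection (verts G)) $ i $ j = (laplacian G *v p) $ i"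
      by (simp add: matrix_matrix_mult_def matrix_vector_mult_def p_def)
    also have "\<dots> = (\<Sum>w | i \<rightarrow>\<^bsub>G\<^esub> w. p $ i - p $ w)"
      by (rule laplacian_mult[OF assms])
    also have "\<dots> = (\<Sum>w | i \<rightarrow>\<^bsub>G\<^esub> w. axis j 1 $ i - axis j 1 $ w)"
      using ends_in_verts
      by (intro sum.cong) (auto simp: p_def zero_sum_projection_def axis_def)
    also have "\<dots> = (laplacian G *v axis j 1) $ i"
      by (rule laplacian_mult[OF assms, symmetric])
    also have "\<dots> = laplacian G $ i $ j"
      by (simp add: matrix_vector_mul_component column_def matrix_vector_mult_basis)
    finally show ?thesis .
  qed
  then show ?thesis by (simp add: vec_eq_iff)
qed

text \<open>An eigenbasis of the zero-sum space leaves out the constant eigenvector. Traces of the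
  projection and of the Laplacian give the number and the sum of the eigenvalues. The index formula
  is conditional on nonzero eigenvalues, which the callers derive from bounds or explicit
  values.\<close>

lemma biharmonic_index_spectrum:
  fixes G :: "('v::finite, 'e) pre_digraph"
  assumes G: "graph G" and ne: "verts G \<noteq> {}"
  obtains B :: "(real^'v) set" and l :: "real^'v \<Rightarrow> real" where
    "finite B" "real (card B) = real (card (verts G)) - 1" "(\<Sum>b\<in>B. l b) = card (arcs_ends G)"
    "\<And>b. b \<in> B \<Longrightarrow> b \<noteq> 0 \<and> b \<in> zero_sum_vectors (verts G) \<and> laplacian G *v b = l b *\<^sub>R b"
    "(\<forall>b\<in>B. l b \<noteq> 0) \<Longrightarrow> biharmonic_index G = card (verts G) * (\<Sum>b\<in>B. 1 / (l b)\<^sup>2)"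
proof -
  interpret graph G by fact
  let ?V = "verts G" and ?L = "laplacian G"
  obtain B where B: "orthonormal_eigenbasis ((*v) ?L) (zero_sum_vectors ?V) B"
    using orthonormal_eigenbasis_exists[OF matrix_vector_mul_linear laplacian_self_adjoint[OF G]
        subspace_zero_sum_vectors] laplacian_zero_sum_vectors[OF G] by blast
  define l where "l b = b \<bullet> (?L *v b)" for b
  have fin: "finite B"
    and on: "\<And>b b'. b \<in> B \<Longrightarrow> b' \<in> B \<Longrightarrow> b \<bullet> b' = (if b = b' then 1 else 0)"
    and ev: "\<And>b. b \<in> B \<Longrightarrow> ?L *v b = l b *\<^sub>R b"
    and BS: "\<And>b. b \<in> B \<Longrightarrow> b \<in> zero_sum_vectors ?V"
    using B unfolding orthonormal_eigenbasis_def l_def by blast+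
  \<comment> \<open>Multiplication by the projection
    \<open>spectral_matrix B (\<lambda>_. 1)\<close> leaves the Laplacian unchanged and, computed on
    eigenvectors, yields \<open>spectral_matrix B l\<close>.\<close>
  have L: "?L = spectral_matrix B l"
    using matrix_mul_spectral_matrix[of B ?L l "\<lambda>_. 1", OF ev]
    by (simp add: spectral_matrix_const_1[OF B ne] laplacian_mult_zero_sum_projection[OF G])
  have tr: "trace (spectral_matrix B g) = (\<Sum>b\<in>B. g b)" for g
    by (simp add: trace_spectral_matrix on)
  have "real (card B) = trace (zero_sum_projection ?V)"
    using tr[of "\<lambda>_. 1"] by (simp add: spectral_matrix_const_1[OF B ne])
  also have "\<dots> = (\<Sum>i\<in>?V. 1 - 1 / card ?V)"
    by (simp add: trace_def zero_sum_projection_def sum.If_cases)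
  also have "\<dots> = real (card ?V) - 1"
    using ne by (simp add: algebra_simps)
  finally have card: "real (card B) = real (card ?V) - 1" .
  have suml: "(\<Sum>b\<in>B. l b) = card (arcs_ends G)"
    using tr[of l] trace_laplacian[OF G] L by simp
  have BH: "biharmonic_index G = card ?V * (\<Sum>b\<in>B. 1 / (l b)\<^sup>2)" if nz: "\<forall>b\<in>B. l b \<noteq> 0"
  proof -
    let ?X = "spectral_matrix B (\<lambda>b. 1 / (l b)\<^sup>2)"
    have "?L ** ?L = spectral_matrix B (\<lambda>b. (l b)\<^sup>2)"
      by (simp add: L spectral_matrix_mul[OF on fin] power2_eq_square)
    then have X: "moore_penrose_inverse (?L ** ?L) = ?X"
      using nz by (simp add: moore_penrose_inverse_spectral_matrix[OF on fin])
    have "(\<Sum>u\<in>?V. ?X $ u $ u) = trace ?X"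
      unfolding trace_def using BS
      by (intro sum.mono_neutral_left) (auto simp: spectral_matrix_def zero_sum_vectors_def)
    then have diag: "(\<Sum>u\<in>?V. ?X $ u $ u) = (\<Sum>b\<in>B. 1 / (l b)\<^sup>2)"
      by (simp add: tr)
    \<comment> \<open>Rows of the pseudoinverse sum to zero because every basis vector does, so the
      cross terms of the distances drop out.\<close>
    have "(\<Sum>v\<in>?V. ?X $ u $ v) = (\<Sum>b\<in>B. 1 / (l b)\<^sup>2 * b $ u * (\<Sum>v\<in>?V. b $ v))" for u
      by (simp add: spectral_matrix_def sum_distrib_left sum.swap[of _ B ?V])
    also have "\<dots> u = 0" for u
      using BS by (intro sum.neutral) (auto simp: zero_sum_vectors_def)
    finally have off: "(\<Sum>v\<in>?V. ?X $ u $ v) = 0" for u .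
    have "biharmonic_index G = 1/2 * (\<Sum>u\<in>?V. \<Sum>v\<in>?V. ?X $ u $ u + ?X $ v $ v - 2 * ?X $ u $ v)"
      by (simp add: biharmonic_index_def biharmonic_distance_sq_def X Let_def)
    \<comment> \<open>Each diagonal entry occurs \<open>card ?V\<close> times through
      \<open>u\<close> and again through \<open>v\<close>; the factor one half absorbs the
      doubling.\<close>
    also have "\<dots> = card ?V * (\<Sum>u\<in>?V. ?X $ u $ u)"
      by (simp add: sum.distrib sum_subtractf off sum_distrib_left[symmetric])
    finally show ?thesis by (simp add: diag)
  qed
  have "b \<noteq> 0" if "b \<in> B" for b
    using on[OF that that] by auto
  then show ?thesis
    using that[of B l] fin card suml ev BS BH by blast
qed

section \<open>The chord bound and graphs of diameter two\<close>

text \<open>For \<open>n > 1\<close> the right-hand side is the chord through the points at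
  \<open>1\<close> and \<open>n\<close>. These are roots of the gap, and factoring them out shows
  its sign.\<close>

lemma reciprocal_square_le_chord:
  fixes x n :: real
  assumes "1 \<le> x" "x \<le> n"
  shows "1 / x\<^sup>2 \<le> 1 - (n + 1) / n\<^sup>2 * (x - 1)"
proof -
  have "1 - (n + 1) / n\<^sup>2 * (x - 1) - 1 / x\<^sup>2 =
      (x - 1) * (n - x) * ((n + 1) * x + n) / (n\<^sup>2 * x\<^sup>2)"
    using assms by (simp add: field_simps power2_eq_square)
  moreover have "\<dots> \<ge> 0"
    using assms by (intro divide_nonneg_nonneg mult_nonneg_nonneg) auto
  ultimately show ?thesis by linarith
qed

text \<open>With unit costs a cheapest path has cost equal to its length, so it consists of at most
  two arcs.\<close>

lemma diameter_two_cases: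
  assumes "fin_digraph G" "graph_diameter G \<le> 2" "u \<in> verts G" "v \<in> verts G"
  shows "u = v \<or> u \<rightarrow>\<^bsub>G\<^esub> v \<or> (\<exists>w. u \<rightarrow>\<^bsub>G\<^esub> w \<and> w \<rightarrow>\<^bsub>G\<^esub> v)"
proof -
  interpret fin_digraph G by fact
  have "\<mu> (\<lambda>_. 1) u v \<le> graph_diameter G"
    unfolding graph_diameter_def by (intro SUP_upper2[OF assms(3)] SUP_upper assms(4))
  with assms(2) have mu: "\<mu> (\<lambda>_. 1) u v \<le> 2"
    by (rule order_trans[rotated])
  \<comment> \<open>A finite distance means reachability, so the minimum is attained by a
    path.\<close>
  then have "u \<rightarrow>\<^sup>*\<^bsub>G\<^esub> v"
    using \<mu>_reach_conv[of "\<lambda>_. 1" u v] by (auto simp: less_top[symmetric])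
  then obtain p where p: "apath u p v" "\<mu> (\<lambda>_. 1) u v = awalk_cost (\<lambda>_. 1) p"
    using min_cost_awalk[of u v "\<lambda>_. 1"] by auto
  have "awalk_cost (\<lambda>_. 1) p = length p"
    by (induction p) auto
  then have "length p \<le> 2"
    using mu p(2) by simp
  then consider "p = []" | e where "p = [e]" | e e' where "p = [e, e']"
    by (cases p; cases "tl p"; cases "tl (tl p)") auto
  then show ?thesis
    using p(1) by cases (auto simp: apath_simps arcs_ends_conv intro: rev_image_eqI)
qed

text \<open>The arcs of a breadth-first tree rooted at \<open>c\<close> give the bound.  If there are no others and some
  vertex lies at distance two from \<open>c\<close>, its only neighbour is its parent, which therefore dominates.\<close>

lemma card_arcs_ends_diameter_two:
  fixes G :: "('v, 'e) pre_digraph"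
  assumes "graph G" "verts G \<noteq> {}"
    and diam: "\<And>u v. u \<in> verts G \<Longrightarrow> v \<in> verts G \<Longrightarrow>
      u = v \<or> u \<rightarrow>\<^bsub>G\<^esub> v \<or> (\<exists>w. u \<rightarrow>\<^bsub>G\<^esub> w \<and> w \<rightarrow>\<^bsub>G\<^esub> v)"
  shows "2 * (card (verts G) - 1) \<le> card (arcs_ends G)"
    and "card (arcs_ends G) = 2 * (card (verts G) - 1) \<Longrightarrow>
      \<exists>c\<in>verts G. \<forall>v\<in>verts G - {c}. c \<rightarrow>\<^bsub>G\<^esub> v"
proof -
  interpret graph G by fact
  obtain c where c: "c \<in> verts G" using assms(2) by blast
  let ?V = "verts G - {c}"
  \<comment> \<open>The parent map of the tree: a neighbour of \<open>c\<close> hangs from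
    \<open>c\<close>, any other vertex from a chosen neighbour of \<open>c\<close>.\<close>
  define p where "p v = (if c \<rightarrow>\<^bsub>G\<^esub> v then c else SOME w. c \<rightarrow>\<^bsub>G\<^esub> w \<and> w \<rightarrow>\<^bsub>G\<^esub> v)" for v
  have far: "c \<rightarrow>\<^bsub>G\<^esub> p v \<and> p v \<rightarrow>\<^bsub>G\<^esub> v" if "v \<in> ?V" "\<not> c \<rightarrow>\<^bsub>G\<^esub> v" for v
    using diam[OF c, of v] that someI_ex[of "\<lambda>w. c \<rightarrow>\<^bsub>G\<^esub> w \<and> w \<rightarrow>\<^bsub>G\<^esub> v"] by (auto simp: p_def)
  have near: "p v = c" if "c \<rightarrow>\<^bsub>G\<^esub> v" for v
    using that by (simp add: p_def)
  have edge: "p v \<rightarrow>\<^bsub>G\<^esub> v" if "v \<in> ?V" for v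
    using far[OF that] near[of v] by (cases "c \<rightarrow>\<^bsub>G\<^esub> v") auto
  let ?up = "(\<lambda>v. (v, p v)) ` ?V" and ?down = "(\<lambda>v. (p v, v)) ` ?V"
  have sub: "?up \<union> ?down \<subseteq> arcs_ends G"
    using edge dominates_commute by blast
  have "?up \<inter> ?down = {}"
  proof -
    \<comment> \<open>A common element would make \<open>v\<close> and \<open>p v\<close> parents of
      each other, but a parent other than \<open>c\<close> is adjacent to \<open>c\<close> and so
      has parent \<open>c\<close>.\<close>
    have False if "v \<in> ?V" "p v \<in> ?V" "p (p v) = v" for v
      using that far near by (metis DiffE insertI1)
    then show ?thesis by auto
  qed
  then have "card (?up \<union> ?down) = card ?up + card ?down"
    by (intro card_Un_disjoint) auto
  also have "\<dots> = 2 * card ?V"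
    by (simp add: card_image inj_on_def)
  finally have card: "card (?up \<union> ?down) = 2 * (card (verts G) - 1)"
    using c by simp
  show "2 * (card (verts G) - 1) \<le> card (arcs_ends G)"
    using card_mono[OF finite_arcs_ends sub] by (simp only: card)
  assume "card (arcs_ends G) = 2 * (card (verts G) - 1)"
  then have "card (?up \<union> ?down) = card (arcs_ends G)"
    by (simp only: card)
  then have E: "?up \<union> ?down = arcs_ends G"
    by (rule card_subset_eq[OF finite_arcs_ends sub])
  show "\<exists>c\<in>verts G. \<forall>v\<in>verts G - {c}. c \<rightarrow>\<^bsub>G\<^esub> v"
  proof (cases "\<forall>v\<in>?V. c \<rightarrow>\<^bsub>G\<^esub> v")
    case False
    then obtain v where v: "v \<in> ?V" "\<not> c \<rightarrow>\<^bsub>G\<^esub> v" by blast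
    \<comment> \<open>All arcs are tree arcs, and \<open>v\<close> is no parent, being neither
      \<open>c\<close> nor adjacent to \<open>c\<close>.\<close>
    have nb: "x = p v" if "v \<rightarrow>\<^bsub>G\<^esub> x" for x
    proof -
      have "x = p v \<or> (x \<in> ?V \<and> v = p x)"
        using that unfolding E[symmetric] by auto
      then show ?thesis
        using far[of x] near[of x] v by auto
    qed
    have "p v \<rightarrow>\<^bsub>G\<^esub> x" if x: "x \<in> verts G - {p v}" for x
    proof (cases "x = v")
      case True
      then show ?thesis using far v by blast
    next
      case False
      then show ?thesis
        using diam[of v x] nb x v(1) by auto
    qed
    then show ?thesis
      using far[OF v] ends_in_verts by blast
  qed (use c in blast)
qed

section \<open>Eigenvalue bounds in diameter two\<close>

lemma diameter_two_laplacian_eigenvalue_bounds: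
  fixes G :: "('v::finite, 'e) pre_digraph"
  assumes G: "graph G"
    and diam: "\<And>u v. u \<in> verts G \<Longrightarrow> v \<in> verts G \<Longrightarrow>
      u = v \<or> u \<rightarrow>\<^bsub>G\<^esub> v \<or> (\<exists>w. u \<rightarrow>\<^bsub>G\<^esub> w \<and> w \<rightarrow>\<^bsub>G\<^esub> v)"
    and x: "x \<noteq> 0" "x \<in> zero_sum_vectors (verts G)" "laplacian G *v x = l *\<^sub>R x"
  shows "1 \<le> l" "l \<le> card (verts G)"
proof -
  interpret graph G by fact
  let ?V = "verts G"
  have sum0: "(\<Sum>v\<in>?V. x $ v) = 0" and out: "\<And>v. v \<notin> ?V \<Longrightarrow> x $ v = 0"
    using x(2) by (auto simp: zero_sum_vectors_def)
  have ev: "l * x $ u = (\<Sum>w | u \<rightarrow>\<^bsub>G\<^esub> w. x $ u - x $ w)" for u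
    using laplacian_mult[OF G, of x u] x(3) by simp
  have ne: "?V \<noteq> {}"
    using x(1) out by (auto simp: vec_eq_iff)
  have "Max (($) x ` ?V) \<in> ($) x ` ?V" "Min (($) x ` ?V) \<in> ($) x ` ?V"
    using ne by (auto intro!: Max_in Min_in simp del: Max_in Min_in)
  then obtain u v where u: "u \<in> ?V" "Max (($) x ` ?V) = x $ u" and v: "v \<in> ?V" "Min (($) x ` ?V) = x $ v"
    by (elim imageE) blast
  have max: "x $ w \<le> x $ u" and min: "x $ v \<le> x $ w" if "w \<in> ?V" for w
    using that by (simp_all flip: u(2) v(2))
  \<comment> \<open>If the maximum were at most zero, the zero sum would make every entry
    vanish.\<close>
  have upos: "x $ u > 0"
  proof (rule ccontr)
    assume "\<not> x $ u > 0"
    then have "x $ w \<le> 0" if "w \<in> ?V" for w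
      using max[OF that] by simp
    then have "\<forall>w\<in>?V. - x $ w = 0"
      using sum_nonneg_eq_0_iff[OF finite_verts, of "\<lambda>w. - x $ w"] sum0 by (simp add: sum_negf)
    then show False
      using x(1) out by (auto simp: vec_eq_iff)
  qed
  \<comment> \<open>Passing from the neighbours to all vertices adds nonnegative terms, and the zero
    sum then evaluates the result.\<close>
  have "(\<Sum>w | u \<rightarrow>\<^bsub>G\<^esub> w. x $ u - x $ w) \<le> (\<Sum>w\<in>?V. x $ u - x $ w)"
    using max ends_in_verts by (intro sum_mono2) auto
  then have "l * x $ u \<le> card ?V * x $ u"
    by (simp add: ev sum_subtractf sum0)
  then show "l \<le> card ?V"
    using upos by simp
  have "\<exists>w\<in>?V. x $ w < 0"
  proof (rule ccontr)
    assume "\<not> ?thesis"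
    then have "(\<Sum>w\<in>?V. x $ w) > 0"
      using u upos by (intro sum_pos2[of _ u]) auto
    then show False using sum0 by simp
  qed
  then have lt: "x $ v < x $ u"
    using min upos by (smt (verit))
  have nonneg: "u \<rightarrow>\<^bsub>G\<^esub> w \<Longrightarrow> 0 \<le> x $ u - x $ w" "v \<rightarrow>\<^bsub>G\<^esub> w \<Longrightarrow> 0 \<le> x $ w - x $ v" for w
    using max min ends_in_verts by auto
  have "x $ u - x $ v \<le> l * (x $ u - x $ v)"
  proof -
    have eq: "l * (x $ u - x $ v) =
        (\<Sum>w | u \<rightarrow>\<^bsub>G\<^esub> w. x $ u - x $ w) + (\<Sum>w | v \<rightarrow>\<^bsub>G\<^esub> w. x $ w - x $ v)"
      using ev[of u] ev[of v] by (simp add: right_diff_distrib sum_subtractf)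
    have nn: "(\<Sum>w | v \<rightarrow>\<^bsub>G\<^esub> w. x $ w - x $ v) \<ge> 0"
      using nonneg by (intro sum_nonneg) auto
    consider "u \<rightarrow>\<^bsub>G\<^esub> v" | w where "u \<rightarrow>\<^bsub>G\<^esub> w" "w \<rightarrow>\<^bsub>G\<^esub> v"
      using diam[OF u(1) v(1)] lt by auto
    then show ?thesis
    proof cases
      case 1
      have "x $ u - x $ v \<le> (\<Sum>w | u \<rightarrow>\<^bsub>G\<^esub> w. x $ u - x $ w)"
        using 1 nonneg by (intro member_le_sum) auto
      then show ?thesis using eq nn by simp
    next
      \<comment> \<open>The middle vertex \<open>w\<close> occurs in both sums, and its two
        contributions telescope to \<open>x $ u - x $ v\<close>.\<close>
      case 2
      have "x $ u - x $ w \<le> (\<Sum>w | u \<rightarrow>\<^bsub>G\<^esub> w. x $ u - x $ w)"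
        using 2 nonneg by (intro member_le_sum) auto
      moreover have "x $ w - x $ v \<le> (\<Sum>w | v \<rightarrow>\<^bsub>G\<^esub> w. x $ w - x $ v)"
        using 2 nonneg dominates_commute by (intro member_le_sum) auto
      ultimately show ?thesis using eq by simp
    qed
  qed
  then show "1 \<le> l"
    using lt by (simp add: mult_le_cancel_right1)
qed

section \<open>Stars and their spectrum\<close>

text \<open>The part of size one is a singleton, so the bipartition reduces to the choice of a
  centre \<open>c\<close>.\<close>

lemma star_iff_dominating_vertex:
  "K\<^bsub>1,n-1\<^esub> G \<longleftrightarrow> graph G \<and> (\<exists>c\<in>verts G. card (verts G - {c}) = n - 1 \<and>
     arcs_ends G = {c} \<times> (verts G - {c}) \<union> (verts G - {c}) \<times> {c})" (is "_ \<longleftrightarrow> graph G \<and> ?R")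
proof -
  have "(\<exists>U V. verts G = U \<union> V \<and> U \<inter> V = {} \<and> card U = 1 \<and> card V = n - 1 \<and>
      arcs_ends G = U \<times> V \<union> V \<times> U) \<longleftrightarrow> ?R" (is "?L \<longleftrightarrow> _")
  proof
    assume ?L
    then obtain U V where UV: "verts G = U \<union> V" "U \<inter> V = {}" "card U = 1" "card V = n - 1"
      "arcs_ends G = U \<times> V \<union> V \<times> U" by blast
    obtain c where c: "U = {c}" using UV(3) card_1_singletonE by blast
    then have "V = verts G - {c}" using UV(1,2) by auto
    then show ?R using c UV(1,4,5) by blast
  next
    assume ?R
    then obtain c where "c \<in> verts G" "card (verts G - {c}) = n - 1"
      "arcs_ends G = {c} \<times> (verts G - {c}) \<union> (verts G - {c}) \<times> {c}" by blast
    then show ?L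
      by - (rule exI[of _ "{c}"], rule exI[of _ "verts G - {c}"], auto)
  qed
  then show ?thesis
    by (simp only: complete_bipartite_digraph_def)
qed

lemma sum_one_minus_mult:
  fixes l :: "'a \<Rightarrow> real"
  shows "(\<Sum>b\<in>B. 1 - k * (l b - 1)) = card B - k * ((\<Sum>b\<in>B. l b) - card B)"
  by (simp add: sum_subtractf flip: sum_distrib_left)

text \<open>The bound on \<open>n\<close> matters: for \<open>n = 0\<close> truncated subtraction
  would again describe a single vertex.\<close>

lemma star_card:
  assumes "K\<^bsub>1,n-1\<^esub> S" "n \<ge> 1"
  shows "card (verts S) = n" "card (arcs_ends S) = 2 * (n - 1)"
proof -
  interpret graph S using assms(1) by (simp add: complete_bipartite_digraph_def)
  obtain c where c: "c \<in> verts S" "card (verts S - {c}) = n - 1"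
      "arcs_ends S = {c} \<times> (verts S - {c}) \<union> (verts S - {c}) \<times> {c}"
    using assms(1) unfolding star_iff_dominating_vertex by blast
  show "card (verts S) = n"
    using c assms(2) card_gt_0_iff[of "verts S"] by (simp add: card_Diff_singleton) force
  have "card (arcs_ends S) = card ({c} \<times> (verts S - {c})) + card ((verts S - {c}) \<times> {c})"
    unfolding c(3) by (intro card_Un_disjoint) auto
  then show "card (arcs_ends S) = 2 * (n - 1)"
    using c(2) by (simp add: card_cartesian_product)
qed

text \<open>The arcs at \<open>c\<close> already exhaust the prescribed number of arcs.\<close>

lemma star_of_dominating_vertex:
  assumes "graph G" "c \<in> verts G" "\<And>v. v \<in> verts G - {c} \<Longrightarrow> c \<rightarrow>\<^bsub>G\<^esub> v"
    and "card (arcs_ends G) = 2 * (card (verts G) - 1)"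
  shows "K\<^bsub>1,card (verts G)-1\<^esub> G"
proof -
  interpret graph G by fact
  let ?V = "verts G - {c}"
  have "card ({c} \<times> ?V \<union> ?V \<times> {c}) = card ({c} \<times> ?V) + card (?V \<times> {c})"
    by (intro card_Un_disjoint) auto
  also have "\<dots> = card (arcs_ends G)"
    using assms(2,4) by (simp add: card_cartesian_product)
  finally have "{c} \<times> ?V \<union> ?V \<times> {c} = arcs_ends G"
    using assms(3) dominates_commute by (intro card_subset_eq finite_arcs_ends) blast+
  then show ?thesis
    using assms(1,2) unfolding star_iff_dominating_vertex by (intro conjI bexI[of _ c]) (simp_all add: card_Diff_singleton)
qed

text \<open>The equation at the centre gives \<open>l = n\<close> unless \<open>x\<close> vanishes
  there; in that case the equation at a leaf with nonzero entry gives \<open>l = 1\<close>.\<close>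

lemma star_laplacian_eigenvalue:
  fixes S :: "('v::finite, 'e) pre_digraph"
  assumes star: "K\<^bsub>1,n-1\<^esub> S" and n: "n \<ge> 1"
    and x: "x \<noteq> 0" "x \<in> zero_sum_vectors (verts S)" "laplacian S *v x = l *\<^sub>R x"
  shows "l = 1 \<or> l = n"
proof -
  have G: "graph S" using star by (simp add: complete_bipartite_digraph_def)
  interpret graph S by fact
  obtain c where c: "c \<in> verts S" "card (verts S - {c}) = n - 1"
      "arcs_ends S = {c} \<times> (verts S - {c}) \<union> (verts S - {c}) \<times> {c}"
    using star unfolding star_iff_dominating_vertex by blast
  let ?V = "verts S - {c}"
  have sum0: "x $ c + (\<Sum>v\<in>?V. x $ v) = 0" and out: "\<And>v. v \<notin> verts S \<Longrightarrow> x $ v = 0"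
    using x(2) c(1) by (auto simp: zero_sum_vectors_def sum.remove)
  have ev: "l * x $ u = (\<Sum>w | u \<rightarrow>\<^bsub>S\<^esub> w. x $ u - x $ w)" for u
    using laplacian_mult[OF G, of x u] x(3) by simp
  have "{w. c \<rightarrow>\<^bsub>S\<^esub> w} = ?V"
    using c(3) by auto
  then have "l * x $ c = (\<Sum>w\<in>?V. x $ c - x $ w)"
    using ev[of c] by simp
  \<comment> \<open>The \<open>n - 1\<close> leaves contribute \<open>x $ c\<close> each, and the
    zero sum supplies one more.\<close>
  also have "\<dots> = n * x $ c"
    using sum0 n c(2) by (simp add: sum_subtractf of_nat_diff algebra_simps)
  finally have centre: "l = n \<or> x $ c = 0" by auto
  moreover have "l = 1" if "x $ c = 0"
  proof -
    obtain v where v: "x $ v \<noteq> 0" using x(1) by (auto simp: vec_eq_iff)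
    then have "v \<in> ?V" using out that by force
    then have "{w. v \<rightarrow>\<^bsub>S\<^esub> w} = {c}"
      using c(3) by auto
    then have "l * x $ v = x $ v" using ev[of v] that by simp
    then show "l = 1" using v by simp
  qed
  ultimately show ?thesis by blast
qed

text \<open>The eigenvalues \<open>1\<close> and \<open>n\<close> are points where the chord meets
  the curve, so the chord bound is exact and only the number and sum of the eigenvalues
  enter.\<close>

lemma biharmonic_index_star:
  fixes S :: "('v::finite, 'e) pre_digraph"
  assumes star: "K\<^bsub>1,n-1\<^esub> S" and n: "n \<ge> 1"
  shows "biharmonic_index S = n * (real n - 1 - (real n + 1) / (real n)\<^sup>2 * (real n - 1))"
proof -
  have G: "graph S" using star by (simp add: complete_bipartite_digraph_def)
  have ne: "verts S \<noteq> {}" using star_card[OF star n] n by auto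
  obtain B and l :: "real^'v \<Rightarrow> real" where B:
    "finite B" "real (card B) = real n - 1" "(\<Sum>b\<in>B. l b) = real (2 * (n - 1))"
    "\<And>b. b \<in> B \<Longrightarrow> b \<noteq> 0 \<and> b \<in> zero_sum_vectors (verts S) \<and> laplacian S *v b = l b *\<^sub>R b"
    "(\<forall>b\<in>B. l b \<noteq> 0) \<Longrightarrow> biharmonic_index S = n * (\<Sum>b\<in>B. 1 / (l b)\<^sup>2)"
    by (rule biharmonic_index_spectrum[OF G ne, unfolded star_card[OF star n]]) (rule that, assumption+)
  have l: "l b = 1 \<or> l b = n" if "b \<in> B" for b
    using star_laplacian_eigenvalue[OF star n] B(4)[OF that] by blast
  have "1 / (l b)\<^sup>2 = 1 - (real n + 1) / (real n)\<^sup>2 * (l b - 1)" if "b \<in> B" for b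
    using l[OF that] n by (auto simp: field_simps power2_eq_square)
  then have "(\<Sum>b\<in>B. 1 / (l b)\<^sup>2) = (\<Sum>b\<in>B. 1 - (real n + 1) / (real n)\<^sup>2 * (l b - 1))"
    by (intro sum.cong) auto
  also have "\<dots> = real n - 1 - (real n + 1) / (real n)\<^sup>2 * (real n - 1)"
    unfolding sum_one_minus_mult B(2,3) using n by (simp add: of_nat_diff)
  finally show ?thesis
    using B(5) l n by force
qed

section \<open>Comparison with the star\<close>

text \<open>Summing the chord bound over the eigenbasis leaves only the trace of the Laplacian,
  which counts the arcs.\<close>

lemma biharmonic_index_diameter_two_le:
  fixes G :: "('v::finite, 'e) pre_digraph"
  assumes G: "graph G" and ne: "verts G \<noteq> {}"
    and diam: "\<And>u v. u \<in> verts G \<Longrightarrow> v \<in> verts G \<Longrightarrow>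
      u = v \<or> u \<rightarrow>\<^bsub>G\<^esub> v \<or> (\<exists>w. u \<rightarrow>\<^bsub>G\<^esub> w \<and> w \<rightarrow>\<^bsub>G\<^esub> v)"
    and n: "n = card (verts G)"
  shows "biharmonic_index G \<le>
    n * (real n - 1 - (real n + 1) / (real n)\<^sup>2 * (real (card (arcs_ends G)) - (real n - 1)))"
proof -
  obtain B and l :: "real^'v \<Rightarrow> real" where B:
    "finite B" "real (card B) = real n - 1" "(\<Sum>b\<in>B. l b) = card (arcs_ends G)"
    "\<And>b. b \<in> B \<Longrightarrow> b \<noteq> 0 \<and> b \<in> zero_sum_vectors (verts G) \<and> laplacian G *v b = l b *\<^sub>R b"
    "(\<forall>b\<in>B. l b \<noteq> 0) \<Longrightarrow> biharmonic_index G = n * (\<Sum>b\<in>B. 1 / (l b)\<^sup>2)"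
    by (rule biharmonic_index_spectrum[OF G ne, folded n]) (rule that, assumption+)
  have l: "1 \<le> l b" "l b \<le> n" if "b \<in> B" for b
    using diameter_two_laplacian_eigenvalue_bounds[OF G diam] B(4)[OF that] unfolding n by blast+
  have "(\<Sum>b\<in>B. 1 / (l b)\<^sup>2) \<le> (\<Sum>b\<in>B. 1 - (real n + 1) / (real n)\<^sup>2 * (l b - 1))"
    by (intro sum_mono reciprocal_square_le_chord l)
  also have "\<dots> = real n - 1 - (real n + 1) / (real n)\<^sup>2 * (real (card (arcs_ends G)) - (real n - 1))"
    by (simp only: sum_one_minus_mult B(2,3))
  finally show ?thesis
    using B(5) l by (force intro: mult_left_mono)
qed

theorem theorem5p3:
  fixes G :: "('v::finite, 'e) pre_digraph"
    and S :: "('w::finite, 'f) pre_digraph"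
    and n :: nat
  assumes "graph G"
    and "Digraph_Component.connected G"
    and "card (verts G) = n"
    and "graph_diameter G = 2"
    and "K\<^bsub>1,n-1\<^esub> S"
  shows "biharmonic_index G \<le> biharmonic_index S \<and>
         (biharmonic_index G = biharmonic_index S \<longleftrightarrow> K\<^bsub>1,n-1\<^esub> G)"
proof -
  interpret graph G by fact
  have ne: "verts G \<noteq> {}"
    using assms(2) by (auto simp: connected_def strongly_connected_def mk_symmetric_def)
  then have n: "n \<ge> 1"
    using assms(3) by (simp add: Suc_le_eq card_gt_0_iff flip: assms(3))
  have diam: "u = v \<or> u \<rightarrow>\<^bsub>G\<^esub> v \<or> (\<exists>w. u \<rightarrow>\<^bsub>G\<^esub> w \<and> w \<rightarrow>\<^bsub>G\<^esub> v)"
    if "u \<in> verts G" "v \<in> verts G" for u v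
    using diameter_two_cases[OF fin_digraph _ that] assms(4) by simp
  define c where "c = (real n + 1) / (real n)\<^sup>2"
  have c: "c > 0" using n by (simp add: c_def)
  have S: "biharmonic_index S = n * (real n - 1 - c * (real n - 1))"
    using biharmonic_index_star[OF assms(5) n] n by (simp add: c_def of_nat_diff add.commute)
  have le: "biharmonic_index G \<le> n * (real n - 1 - c * (real (card (arcs_ends G)) - (real n - 1)))"
    using biharmonic_index_diameter_two_le[OF assms(1) ne diam assms(3)[symmetric]]
    by (simp add: c_def add.commute)
  have card: "2 * (n - 1) \<le> card (arcs_ends G)"
    using card_arcs_ends_diameter_two(1)[OF assms(1) ne diam] assms(3) by simp
  \<comment> \<open>Every arc beyond \<open>2 * (n - 1)\<close> strictly lowers the affine bound,
    whose value at \<open>2 * (n - 1)\<close> is the index of the star.\<close>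
  have strict: "biharmonic_index G < biharmonic_index S" if "card (arcs_ends G) \<noteq> 2 * (n - 1)"
  proof -
    have "real (2 * (n - 1)) < real (card (arcs_ends G))"
      using that card by (simp only: of_nat_less_iff)
    then have "2 * (real n - 1) < card (arcs_ends G)"
      using n by (simp add: of_nat_diff)
    then have "c * (real n - 1) < c * (real (card (arcs_ends G)) - (real n - 1))"
      using c by (intro mult_strict_left_mono) auto
    then have "n * (real n - 1 - c * (real (card (arcs_ends G)) - (real n - 1))) < biharmonic_index S"
      unfolding S using n by (intro mult_strict_left_mono) auto
    with le show ?thesis by simp
  qed
  have star: "K\<^bsub>1,n-1\<^esub> G" if "card (arcs_ends G) = 2 * (n - 1)"
    using card_arcs_ends_diameter_two(2)[OF assms(1) ne diam] that
      star_of_dominating_vertex[OF assms(1)] assms(3) by blast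
  \<comment> \<open>The index of a star depends only on \<open>n\<close>, so the vertex types of
    \<open>G\<close> and \<open>S\<close> may differ.\<close>
  have eq: "biharmonic_index G = biharmonic_index S" if "K\<^bsub>1,n-1\<^esub> G"
    using biharmonic_index_star[OF that n] biharmonic_index_star[OF assms(5) n] by simp
  show ?thesis
    using strict star eq by force
qed

end
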